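(* Let $r\ge0$, let $\mathcal{I}$ be a $P$-ideal on $\mathbb{N}$, let $\{\omega_t\}_{t\in\mathbb{N}}$ be a weighted sequence, and let $\{x_t\}_{t\in\mathbb{N}}$ be a sequence in a uniformly convex normed space $X$. Then the set $(\omega_t,\mathcal{I})\text{-}\mathrm{LIM}^r x_t$ is strictly convex in $X$.
   Context: A sequence $\{\omega_t\}_{t\in\mathbb{N}}$ of real numbers is a weighted sequence if there is $\beta>0$ with $\omega_t>\beta$ for all $t\in\mathbb{N}$. An ideal on $\mathbb{N}$ is a family $\mathcal{I}\subseteq\mathcal{P}(\mathbb{N})$ with $\varnothing\in\mathcal{I}$, closed under finite unions and under taking subsets. A $P$-ideal is an ideal $\mathcal{I}$ such that for every sequence $\{A_t\}_{t\in\mathbb{N}}$ in $\mathcal{I}$ there is $A\in\mathcal{I}$ with $A_t\setminus A$ finite for each $t$. For $r\ge0$, $(\omega_t,\mathcal{I})\text{-}\mathrm{LIM}^r x_t$ is the set of all $x_*\in X$ such that $\{t\in\mathbb{N}:\omega_t\|x_t-x_*\|>r+\varepsilon\}\in\mathcal{I}$ for every $\varepsilon>0$. A subset $C\subseteq X$ is strictly convex if its interior contains the open line segment connecting any two distinct points of $C$ (so empty sets and singletons are strictly convex). $X$ is uniformly convex if for each $\varepsilon\in(0,2]$ there is $\delta>0$ such that $\|\tfrac{x+y}{2}\|\le 1-\delta$ whenever $\|x\|=\|y\|=1$ and $\|x-y\|\ge\varepsilon$. *)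

theory Defs
  imports "HOL-Analysis.Analysis"
begin

definition weighted_seq :: "(nat \<Rightarrow> real) \<Rightarrow> bool" where
  "weighted_seq \<omega> \<longleftrightarrow> (\<exists>\<beta>>0. \<forall>t. \<omega> t > \<beta>)"

(* Neither properness (UNIV \<notin> I) nor admissibility (all finite sets belong to I) is required. *)
definition nat_ideal :: "nat set set \<Rightarrow> bool" where
  "nat_ideal I \<longleftrightarrow> {} \<in> I \<and> (\<forall>A\<in>I. \<forall>B\<in>I. A \<union> B \<in> I) \<and> (\<forall>A\<in>I. \<forall>B. B \<subseteq> A \<longrightarrow> B \<in> I)"

definition P_ideal :: "nat set set \<Rightarrow> bool" where
  "P_ideal I \<longleftrightarrow> nat_ideal I \<and>
     (\<forall>A :: nat \<Rightarrow> nat set. (\<forall>t. A t \<in> I) \<longrightarrow> (\<exists>B\<in>I. \<forall>t. finite (A t - B)))"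

definition weighted_ideal_LIM ::
  "(nat \<Rightarrow> real) \<Rightarrow> nat set set \<Rightarrow> real \<Rightarrow> (nat \<Rightarrow> 'a::real_normed_vector) \<Rightarrow> 'a set" where
  "weighted_ideal_LIM \<omega> I r x = {l. \<forall>\<epsilon>>0. {t. \<omega> t * norm (x t - l) > r + \<epsilon>} \<in> I}"

definition strictly_convex :: "'a::real_normed_vector set \<Rightarrow> bool" where
  "strictly_convex C \<longleftrightarrow> (\<forall>a\<in>C. \<forall>b\<in>C. a \<noteq> b \<longrightarrow> open_segment a b \<subseteq> interior C)"

(* A property of the whole normed space, i.e. of the type 'a with its norm. *)
definition uniformly_convex :: "'a::real_normed_vector itself \<Rightarrow> bool" where
  "uniformly_convex _ \<longleftrightarrow>
     (\<forall>\<epsilon>::real. 0 < \<epsilon> \<and> \<epsilon> \<le> 2 \<longrightarrow>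
       (\<exists>\<delta>>0. \<forall>x y :: 'a. norm x = 1 \<and> norm y = 1 \<and> norm (x - y) \<ge> \<epsilon> \<longrightarrow>
          norm ((x + y) /\<^sub>R 2) \<le> 1 - \<delta>))"

end

theory Submission
  imports Defs
begin

text \<open>
  Let \<open>a \<noteq> b\<close> be limit points and put \<open>d = norm (a - b)\<close>. For \<open>s = r + \<epsilon>\<close>, all indices \<open>t\<close> outside
  a set of the ideal satisfy \<open>\<omega> t * norm (x t - a) \<le> s\<close> and the same bound for \<open>b\<close>. By the triangle
  inequality \<open>\<omega> t * d \<le> 2 * s\<close> at such \<open>t\<close>, so the existence of two limit points
  bounds the weights from above along these good indices. Together with the lower bound \<open>\<omega> t > \<beta>\<close>
  this makes the geometry uniform in \<open>t\<close>: after rescaling by \<open>\<omega> t / s\<close>, the vectors \<open>x t - a\<close> and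
  \<open>x t - b\<close> lie in the unit ball at a distance bounded below independently of \<open>t\<close> and of \<open>\<epsilon> \<le> 1\<close>.
  Uniform convexity then shrinks an interior convex combination by a fixed factor \<open>1 - \<kappa>\<close>
  (lemma \<open>uniformly_convex_segment\<close>), so an inner point \<open>c\<close> of the segment satisfies
  \<open>\<omega> t * norm (x t - c) \<le> s * (1 - \<kappa>)\<close>.

  If there is a good index at all, then \<open>s \<ge> \<beta> * d / 2\<close>, so the gain \<open>s * \<kappa>\<close> has a positive lower
  bound that does not involve \<open>\<epsilon>\<close>; choosing \<open>\<epsilon>\<close> at most half of that bound leaves
  \<open>\<omega> t * norm (x t - c)\<close> smaller than \<open>r\<close> by a fixed margin. This also covers \<open>r = 0\<close>, where the
  negative bound shows that there are no good indices and every point is a limit point. The upper bound on the weights converts this margin into a radius \<open>\<rho>\<close> such that every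
  point of \<open>ball c \<rho>\<close> is a limit point, witnessed by one exceptional set for all tolerances.
\<close>

text \<open>
  Uniform convexity is a condition on unit vectors; rescaling arguments need it on the closed ball.
  If one of the vectors is noticeably shorter than 1, the triangle inequality alone makes the
  midpoint short. Otherwise both are close to their normalisations, whose midpoint is short.
\<close>

lemma uniformly_convex_unit_ball:
  fixes \<epsilon> :: real
  assumes "uniformly_convex TYPE('a::real_normed_vector)" and "\<epsilon> > 0"
  shows "\<exists>\<delta>>0. \<forall>x y :: 'a. norm x \<le> 1 \<and> norm y \<le> 1 \<and> norm (x - y) \<ge> \<epsilon> \<longrightarrow>
           norm ((x + y) /\<^sub>R 2) \<le> 1 - \<delta>"
proof -
  define \<eta> where "\<eta> = min (\<epsilon> / 2) 2"
  have "0 < \<eta>" "\<eta> \<le> 2" using assms(2) by (auto simp: \<eta>_def)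
  then obtain \<delta> where \<delta>: "\<delta> > 0"
    and sphere: "\<And>x y :: 'a. norm x = 1 \<Longrightarrow> norm y = 1 \<Longrightarrow> norm (x - y) \<ge> \<eta> \<Longrightarrow>
          norm ((x + y) /\<^sub>R 2) \<le> 1 - \<delta>"
    using assms(1) unfolding uniformly_convex_def by metis
  \<comment> \<open>Vectors shorter than \<open>1 - \<theta>\<close> count as short. Normalising the others moves each by at most
      \<open>\<theta>\<close>; this costs at most half of the separation \<open>\<epsilon>\<close> and half of the gain \<open>\<delta>\<close>.\<close>
  define \<theta> where "\<theta> = min (1/2) (min (\<epsilon> / 4) (\<delta> / 2))"
  have \<theta>: "\<theta> > 0" "\<theta> \<le> 1/2" "\<theta> \<le> \<epsilon> / 4" "\<theta> \<le> \<delta> / 2"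
    using assms(2) \<delta> by (auto simp: \<theta>_def)
  have "norm ((x + y) /\<^sub>R 2) \<le> 1 - \<theta> / 2"
    if xy: "norm x \<le> 1" "norm y \<le> 1" "norm (x - y) \<ge> \<epsilon>" for x y :: 'a
  proof (cases "norm x < 1 - \<theta> \<or> norm y < 1 - \<theta>")
    case True
    then show ?thesis using xy norm_triangle_ineq[of x y] by auto
  next
    case False
    then have long: "norm x \<ge> 1 - \<theta>" "norm y \<ge> 1 - \<theta>" by auto
    have normalise: "norm (sgn z) = 1 \<and> norm (z - sgn z) \<le> \<theta>"
      if "norm z \<ge> 1 - \<theta>" "norm z \<le> 1" for z :: 'a
    proof -
      have z: "z \<noteq> 0" using that \<theta> by auto
      have "z - sgn z = (norm z - 1) *\<^sub>R sgn z"
        using z by (simp add: sgn_div_norm algebra_simps)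
      then have "norm (z - sgn z) = 1 - norm z"
        using z that by (simp add: norm_sgn)
      then show ?thesis using z that by (simp add: norm_sgn)
    qed
    note nx = normalise[OF long(1) xy(1)] and ny = normalise[OF long(2) xy(2)]
    have "norm (x - y) \<le> norm (sgn x - sgn y) + norm (x - sgn x) + norm (y - sgn y)"
      by norm
    then have "norm (sgn x - sgn y) \<ge> \<eta>"
      using xy(3) nx ny \<theta>(3) by (auto simp: \<eta>_def min_def)
    then have "norm ((sgn x + sgn y) /\<^sub>R 2) \<le> 1 - \<delta>"
      using sphere nx ny by blast
    moreover have "norm (x + y) \<le> norm (sgn x + sgn y) + norm (x - sgn x) + norm (y - sgn y)"
      by norm
    ultimately show ?thesis
      using nx ny \<theta>(1,4) by auto
  qed
  then show ?thesis using \<theta>(1) by (intro exI[of _ "\<theta> / 2"]) auto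
qed

text \<open>
  A point of the segment in the half nearer to \<open>x\<close> is a convex combination of \<open>x\<close> and the midpoint,
  so it inherits the gain at the midpoint, scaled by the coefficient \<open>2 * u\<close>.
\<close>

lemma uniformly_convex_segment:
  fixes \<epsilon> u :: real
  assumes "uniformly_convex TYPE('a::real_normed_vector)" and "\<epsilon> > 0" and "0 < u" "u < 1"
  shows "\<exists>\<kappa>>0. \<forall>x y :: 'a. norm x \<le> 1 \<and> norm y \<le> 1 \<and> norm (x - y) \<ge> \<epsilon> \<longrightarrow>
           norm ((1 - u) *\<^sub>R x + u *\<^sub>R y) \<le> 1 - \<kappa>"
proof -
  obtain \<delta> where \<delta>: "\<delta> > 0"
    and mid: "\<And>x y :: 'a. norm x \<le> 1 \<Longrightarrow> norm y \<le> 1 \<Longrightarrow> norm (x - y) \<ge> \<epsilon> \<Longrightarrow>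
          norm ((x + y) /\<^sub>R 2) \<le> 1 - \<delta>"
    using uniformly_convex_unit_ball[OF assms(1,2)] by metis
  have near: "norm ((1 - v) *\<^sub>R x + v *\<^sub>R y) \<le> 1 - 2 * v * \<delta>"
    if v: "0 < v" "v \<le> 1/2" and xy: "norm x \<le> 1" "norm y \<le> 1" "norm (x - y) \<ge> \<epsilon>"
    for v and x y :: 'a
  proof -
    have "(1 - v) *\<^sub>R x + v *\<^sub>R y = (1 - 2 * v) *\<^sub>R x + (2 * v) *\<^sub>R ((x + y) /\<^sub>R 2)"
      by (simp add: algebra_simps flip: scaleR_add_left)
    then have "norm ((1 - v) *\<^sub>R x + v *\<^sub>R y)
        \<le> norm ((1 - 2 * v) *\<^sub>R x) + norm ((2 * v) *\<^sub>R ((x + y) /\<^sub>R 2))"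
      by (metis norm_triangle_ineq)
    also have "\<dots> = (1 - 2 * v) * norm x + 2 * v * norm ((x + y) /\<^sub>R 2)"
      using v by simp
    also have "\<dots> \<le> (1 - 2 * v) * 1 + 2 * v * (1 - \<delta>)"
      using v xy mid[OF xy] by (intro add_mono mult_left_mono) auto
    finally show ?thesis by (simp add: algebra_simps)
  qed
  define m where "m = min u (1 - u)"
  have "norm ((1 - u) *\<^sub>R x + u *\<^sub>R y) \<le> 1 - 2 * m * \<delta>"
    if "norm x \<le> 1" "norm y \<le> 1" "norm (x - y) \<ge> \<epsilon>" for x y :: 'a
  proof (cases "u \<le> 1/2")
    case True
    then show ?thesis using near[of u x y] that assms(3) by (simp add: m_def)
  next
    case False
    then show ?thesis
      using near[of "1 - u" y x] that assms(4)
      by (simp add: m_def norm_minus_commute add.commute)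
  qed
  moreover have "2 * m * \<delta> > 0" using assms(3,4) \<delta> by (simp add: m_def)
  ultimately show ?thesis by blast
qed

theorem theorem2p12:
  fixes r :: real
    and I :: "nat set set"
    and \<omega> :: "nat \<Rightarrow> real"
    and x :: "nat \<Rightarrow> 'a::real_normed_vector"
  assumes "r \<ge> 0"
    and "P_ideal I"
    and "weighted_seq \<omega>"
    and "uniformly_convex TYPE('a)"
  shows "strictly_convex (weighted_ideal_LIM \<omega> I r x)"
  unfolding strictly_convex_def
proof (intro ballI impI subsetI)
  fix a b c
  assume a: "a \<in> weighted_ideal_LIM \<omega> I r x" and b: "b \<in> weighted_ideal_LIM \<omega> I r x"
    and "a \<noteq> b" and "c \<in> open_segment a b"
  then obtain u where u: "0 < u" "u < 1" and c: "c = (1 - u) *\<^sub>R a + u *\<^sub>R b"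
    by (auto simp: in_segment)
  have union: "A \<union> B \<in> I" if "A \<in> I" "B \<in> I" for A B
    using assms(2) that by (simp add: P_ideal_def nat_ideal_def)
  have subset: "B \<in> I" if "A \<in> I" "B \<subseteq> A" for A B
    using assms(2) that unfolding P_ideal_def nat_ideal_def by blast
  obtain \<beta> where \<beta>: "\<beta> > 0" "\<And>t. \<omega> t > \<beta>"
    using assms(3) by (auto simp: weighted_seq_def)
  define d where "d = norm (a - b)"
  have d: "d > 0" using \<open>a \<noteq> b\<close> by (simp add: d_def)
  have "\<beta> * d / (r + 1) > 0" using \<beta>(1) d assms(1) by simp
  then obtain \<kappa> where \<kappa>: "\<kappa> > 0"
    and convex: "\<And>p q :: 'a. norm p \<le> 1 \<Longrightarrow> norm q \<le> 1 \<Longrightarrow> norm (p - q) \<ge> \<beta> * d / (r + 1) \<Longrightarrow>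
          norm ((1 - u) *\<^sub>R p + u *\<^sub>R q) \<le> 1 - \<kappa>"
    using uniformly_convex_segment[OF assms(4) _ u] by metis
  \<comment> \<open>The gain \<open>s * \<kappa>\<close> is at least \<open>2 * g\<close>: one \<open>g\<close> pays for \<open>\<epsilon>\<close>, and the other for the radius \<open>\<rho>\<close>,
      as \<open>2 * (r + 1) / d\<close> bounds the weights at the good indices.\<close>
  define g where "g = \<kappa> * \<beta> * d / 4"
  define \<epsilon> where "\<epsilon> = min 1 g"
  define s where "s = r + \<epsilon>"
  define \<rho> where "\<rho> = g * d / (2 * (r + 1))"
  have g: "g > 0" using \<kappa> \<beta>(1) d by (simp add: g_def)
  have \<epsilon>: "\<epsilon> > 0" "\<epsilon> \<le> 1" "\<epsilon> \<le> g" using g by (auto simp: \<epsilon>_def)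
  have s: "s > 0" "s \<le> r + 1" using \<epsilon> assms(1) by (auto simp: s_def)
  have \<rho>: "\<rho> > 0" using g d assms(1) by (simp add: \<rho>_def)
  define E where "E = {t. \<omega> t * norm (x t - a) > s} \<union> {t. \<omega> t * norm (x t - b) > s}"
  have E: "E \<in> I"
    using a b \<epsilon>(1) unfolding E_def s_def weighted_ideal_LIM_def by (intro union) auto
  have good: "\<omega> t * norm (x t - y) \<le> r" if t: "t \<notin> E" and y: "y \<in> ball c \<rho>" for t y
  proof -
    have w: "\<omega> t > 0" "\<omega> t > \<beta>" using \<beta>(1) \<beta>(2)[of t] by auto
    have ta: "\<omega> t * norm (x t - a) \<le> s" and tb: "\<omega> t * norm (x t - b) \<le> s"
      using t by (auto simp: E_def)
    have "d \<le> norm (x t - a) + norm (x t - b)" unfolding d_def by norm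
    then have "\<omega> t * d \<le> \<omega> t * norm (x t - a) + \<omega> t * norm (x t - b)"
      using w(1) by (simp flip: distrib_left)
    then have wd: "\<omega> t * d \<le> 2 * s" using ta tb by simp
    have bd: "\<beta> * d \<le> \<omega> t * d" using w(2) d by simp
    define p q where "p = (\<omega> t / s) *\<^sub>R (x t - a)" and "q = (\<omega> t / s) *\<^sub>R (x t - b)"
    have "p - q = (\<omega> t / s) *\<^sub>R (b - a)"
      by (simp add: p_def q_def algebra_simps)
    then have "norm (p - q) = \<omega> t * d / s"
      using w(1) s(1) by (simp add: d_def norm_minus_commute)
    moreover have "\<beta> * d / (r + 1) \<le> \<omega> t * d / s"
      using bd s \<beta>(1) d w(1) by (intro frac_le) auto
    moreover have "norm p \<le> 1" "norm q \<le> 1"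
      using ta tb w(1) s(1) by (auto simp: p_def q_def)
    ultimately have "norm ((1 - u) *\<^sub>R p + u *\<^sub>R q) \<le> 1 - \<kappa>" using convex by metis
    moreover have "(1 - u) *\<^sub>R k *\<^sub>R (z - a) + u *\<^sub>R k *\<^sub>R (z - b) = k *\<^sub>R (z - c)" for k z
      by (simp add: c algebra_simps)
    then have "(1 - u) *\<^sub>R p + u *\<^sub>R q = (\<omega> t / s) *\<^sub>R (x t - c)"
      unfolding p_def q_def .
    ultimately have "norm ((\<omega> t / s) *\<^sub>R (x t - c)) \<le> 1 - \<kappa>" by metis
    then have "\<omega> t / s * norm (x t - c) \<le> 1 - \<kappa>"
      unfolding norm_scaleR using w(1) s(1) by simp
    then have "\<omega> t * norm (x t - c) \<le> s * (1 - \<kappa>)"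
      using w(1) s(1) by (simp add: field_simps)
    moreover have "\<kappa> * (\<beta> * d) \<le> \<kappa> * (2 * s)"
      using bd wd \<kappa> by (intro mult_left_mono) auto
    then have "s * \<kappa> \<ge> 2 * g" by (simp add: g_def algebra_simps)
    ultimately have tc: "\<omega> t * norm (x t - c) \<le> r - g"
      using \<epsilon>(3) by (simp add: s_def algebra_simps)
    have "\<omega> t * \<rho> = (\<omega> t * d) * g / (2 * (r + 1))" by (simp add: \<rho>_def)
    also have "\<dots> \<le> (2 * (r + 1)) * g / (2 * (r + 1))"
      using wd s g assms(1) by (intro divide_right_mono mult_right_mono) auto
    also have "\<dots> = g" using assms(1) by simp
    finally have "\<omega> t * \<rho> \<le> g" .
    moreover have "norm (x t - y) \<le> norm (x t - c) + norm (c - y)" by norm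
    then have "norm (x t - y) \<le> norm (x t - c) + \<rho>" using y by (simp add: dist_norm)
    then have "\<omega> t * norm (x t - y) \<le> \<omega> t * norm (x t - c) + \<omega> t * \<rho>"
      using w(1) by (simp flip: distrib_left)
    ultimately show ?thesis using tc by simp
  qed
  have "ball c \<rho> \<subseteq> weighted_ideal_LIM \<omega> I r x"
  proof
    fix y assume y: "y \<in> ball c \<rho>"
    have "{t. \<omega> t * norm (x t - y) > r + \<epsilon>'} \<subseteq> E" if "\<epsilon>' > 0" for \<epsilon>'
      using good[OF _ y] that by force
    then show "y \<in> weighted_ideal_LIM \<omega> I r x"
      using subset[OF E] by (simp add: weighted_ideal_LIM_def)
  qed
  then show "c \<in> interior (weighted_ideal_LIM \<omega> I r x)"
    using \<rho> by (auto simp: mem_interior)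
qed

end
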